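(* Let $F$ be an $L_0$-zero-order smooth operator, i.e. $\|F(x)-F(y)\|\le L_0\|x-y\|$ for all $x,y\in\mathcal X$. Let $m$ be the memory size and let the pairs $(s_i,y_i)$, $i=0,\dots,m-1$, be chosen either by the operator-history rule or by the JVP-sampling rule (see context). (1) (L-Broyden) For the $m$-memory L-Broyden approximation $J_x=J^m$ of the Jacobian $\nabla F(x)$, defined iteratively by $$J^{i+1}=J^i+\frac{(y_i-J^is_i)s_i^\top}{s_i^\top s_i},\qquad i=0,\dots,m-1,$$ with $0\preceq J^0\preceq L_0I$, the inexactness condition $\|\nabla F(x)-J_x\|\le\delta$ holds with $\delta\le(m+2)L_0$. (2) (Damped L-Broyden) For the $m$-memory Damped L-Broyden approximation $J_x=J^m$ of the Jacobian $\nabla F(x)$, defined iteratively by $$J^{i+1}=J^i+\frac1{m+1}\,\frac{(y_i-J^is_i)s_i^\top}{s_i^\top s_i},\qquad i=0,\dots,m-1,$$ with $0\preceq J^0\preceq\frac{L_0}{m+1}I$, the inexactness condition $\|\nabla F(x)-J_x\|\le\delta$ holds with $\delta\le2L_0$.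
   Context: $\mathcal X\subseteq\mathbb R^d$ is a closed bounded convex set, $F:\mathcal X\to\mathbb R^d$ is a continuous, differentiable operator with Jacobian $\nabla F$, and $x\in\mathcal X$. $\|\cdot\|$ is the Euclidean norm for vectors and the operator norm for matrices; $J^0\in\mathbb R^{d\times d}$, $I$ is the identity matrix, and $\preceq$ is the Loewner order. Operator-history rule: $s_i=z_{i+1}-z_i$ and $y_i=F(z_{i+1})-F(z_i)$, where $z_0,z_1,\dots$ are points at which the operator has been evaluated. JVP-sampling rule (Jacobian-vector products): $y_i=\nabla F(x)s_i$, where $s_i$ are random vectors uniformly distributed on the unit sphere, so that $\|s_i\|=1$, and $s_0,\dots,s_{m-1}$ are linearly independent.
   Formalization: The set X is additionally assumed to have nonempty interior; otherwise the Jacobian is not determined by F on X and the bound can fail (X a segment on the first axis of R^2, F(a,b)=(0,100b), L_0=0, operator-history pairs). *)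

theory Defs
  imports "HOL-Probability.Probability"
begin

definition matrix_opnorm :: "real^'n^'m \<Rightarrow> real" where
  "matrix_opnorm A = onorm (\<lambda>v. A *v v)"

(* The Loewner order compares symmetric matrices: symmetry is part of the definition,
   since nonnegativity of the quadratic form alone does not imply it over the reals. *)
definition loewner_le :: "real^'n^'n \<Rightarrow> real^'n^'n \<Rightarrow> bool"  (infix \<open>\<preceq>\<^sub>L\<close> 50) where
  "A \<preceq>\<^sub>L B \<longleftrightarrow> transpose A = A \<and> transpose B = B \<and> (\<forall>v. 0 \<le> v \<bullet> ((B - A) *v v))"

definition outer :: "real^'n \<Rightarrow> real^'n \<Rightarrow> real^'n^'n" where
  "outer u v = (\<chi> i j. u $ i * v $ j)"

(* J^0, J^1, ... with step size a in front of the rank-one correction. If s i = 0, division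
   by zero being zero makes the update trivial: J^(i+1) = J^i. *)
primrec broyden_iter ::
  "real \<Rightarrow> (nat \<Rightarrow> real^'n) \<Rightarrow> (nat \<Rightarrow> real^'n) \<Rightarrow> real^'n^'n \<Rightarrow> nat \<Rightarrow> real^'n^'n" where
  "broyden_iter a s y J0 0 = J0"
| "broyden_iter a s y J0 (Suc i) =
     broyden_iter a s y J0 i +
     a *\<^sub>R ((1 / (s i \<bullet> s i)) *\<^sub>R outer (y i - broyden_iter a s y J0 i *v s i) (s i))"

definition l_broyden ::
  "nat \<Rightarrow> (nat \<Rightarrow> real^'n) \<Rightarrow> (nat \<Rightarrow> real^'n) \<Rightarrow> real^'n^'n \<Rightarrow> real^'n^'n" where
  "l_broyden m s y J0 = broyden_iter 1 s y J0 m"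

definition damped_l_broyden ::
  "nat \<Rightarrow> (nat \<Rightarrow> real^'n) \<Rightarrow> (nat \<Rightarrow> real^'n) \<Rightarrow> real^'n^'n \<Rightarrow> real^'n^'n" where
  "damped_l_broyden m s y J0 = broyden_iter (1 / (real m + 1)) s y J0 m"

definition operator_history ::
  "(real^'n) set \<Rightarrow> (real^'n \<Rightarrow> real^'n) \<Rightarrow> nat \<Rightarrow> (nat \<Rightarrow> real^'n) \<Rightarrow> (nat \<Rightarrow> real^'n) \<Rightarrow> bool" where
  "operator_history X F m s y \<longleftrightarrow>
     (\<exists>z. (\<forall>i\<le>m. z i \<in> X) \<and>
          (\<forall>i<m. s i = z (Suc i) - z i \<and> y i = F (z (Suc i)) - F (z i)))"

(* The uniform distribution on the unit sphere, as the law of v / norm v for v uniformly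
   distributed in the unit ball (sgn v is v /\<^sub>R norm v). *)
definition uniform_sphere :: "(real^'n) measure" where
  "uniform_sphere = distr (uniform_measure lborel (ball 0 1)) borel sgn"

(* J is the Jacobian at the point of interest. The s i are not assumed to be stochastically
   independent; inj_on makes the family, not just its set of values, linearly independent. *)
definition jvp_sampling ::
  "'w measure \<Rightarrow> real^'n^'n \<Rightarrow> nat \<Rightarrow> (nat \<Rightarrow> 'w \<Rightarrow> real^'n) \<Rightarrow> (nat \<Rightarrow> 'w \<Rightarrow> real^'n) \<Rightarrow> bool" where
  "jvp_sampling M J m s y \<longleftrightarrow>
     (\<forall>i<m. s i \<in> borel_measurable M \<and> distr M borel (s i) = uniform_sphere \<and>
            (\<forall>w\<in>space M. norm (s i w) = 1 \<and> y i w = J *v s i w)) \<and>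
     (AE w in M. inj_on (\<lambda>i. s i w) {..<m} \<and> independent ((\<lambda>i. s i w) ` {..<m}))"

(* The pairs are modelled on a sample space M under both rules; deterministic evaluation
   points are the case of random variables constant in w (or of a one-point space). *)
definition broyden_pairs ::
  "'w measure \<Rightarrow> (real^'n) set \<Rightarrow> (real^'n \<Rightarrow> real^'n) \<Rightarrow> real^'n \<Rightarrow> nat \<Rightarrow>
   (nat \<Rightarrow> 'w \<Rightarrow> real^'n) \<Rightarrow> (nat \<Rightarrow> 'w \<Rightarrow> real^'n) \<Rightarrow> bool" where
  "broyden_pairs M X F x m s y \<longleftrightarrow>
     (\<forall>w\<in>space M. operator_history X F m (\<lambda>i. s i w) (\<lambda>i. y i w)) \<or>
     jvp_sampling M (jacobian F (at x within X)) m s y"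

end

theory Submission
  imports Defs
begin

text \<open>
  The three matrices in play are each bounded in operator norm, and the triangle inequality
  does the rest.

  \<^item> The Jacobian satisfies \<open>\<parallel>\<nabla>F(x)\<parallel> \<le> L\<^sub>0\<close>, also when \<open>x\<close> lies on the boundary of \<open>X\<close>
    (\<open>lipschitz_on_imp_derivative_bound\<close>). By this or by the Lipschitz condition itself,
    every pair satisfies \<open>\<parallel>y\<^sub>i\<parallel> \<le> L\<^sub>0 \<parallel>s\<^sub>i\<parallel>\<close>, whichever rule produced it.
  \<^item> The Loewner bounds on \<open>J\<^sup>0\<close> bound its operator norm
    (\<open>matrix_opnorm_le_if_loewner_between\<close>).
  \<^item> A Broyden step with factor \<open>a\<close> reads
    \<open>J\<^sup>+ v = J (v - a P v) + a ((s \<bullet> v) / (s \<bullet> s)) y\<close>, where \<open>P\<close> is the orthogonal projection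
    onto the line of \<open>s\<close>. For \<open>0 \<le> a \<le> 1\<close> the map \<open>1 - a P\<close> is a contraction, so a step adds
    at most \<open>a L\<^sub>0\<close> to the norm (\<open>matrix_opnorm_broyden_iter_le\<close>).

  After \<open>m\<close> steps the approximation has norm at most \<open>\<parallel>J\<^sup>0\<parallel> + m a L\<^sub>0\<close>. This is
  at most \<open>(m + 1) L\<^sub>0\<close> for \<open>a = 1\<close> and \<open>L\<^sub>0\<close> for \<open>a = 1 / (m + 1)\<close> with the smaller \<open>J\<^sup>0\<close>; the
  Jacobian contributes the last \<open>L\<^sub>0\<close>.
\<close>

section \<open>The matrix operator norm\<close>

lemma matrix_opnorm_le:
  assumes "\<And>v. norm (A *v v) \<le> C * norm v"
  shows "matrix_opnorm A \<le> C"
  unfolding matrix_opnorm_def using assms by (rule onorm_le)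

lemma norm_matrix_vector_mult_le: "norm (A *v v) \<le> matrix_opnorm A * norm v"
  unfolding matrix_opnorm_def by (rule onorm[OF matrix_vector_mul_bounded_linear])

lemma matrix_opnorm_diff_le:
  "matrix_opnorm (A - B) \<le> matrix_opnorm A + matrix_opnorm B"
proof (rule matrix_opnorm_le)
  fix v
  show "norm ((A - B) *v v) \<le> (matrix_opnorm A + matrix_opnorm B) * norm v"
    using norm_matrix_vector_mult_le[of A v] norm_matrix_vector_mult_le[of B v]
      norm_triangle_ineq4[of "A *v v" "B *v v"]
    by (simp add: matrix_vector_mult_diff_rdistrib distrib_right)
qed

lemma outer_mult_vector: "outer u v *v w = (v \<bullet> w) *\<^sub>R u"
  by (simp add: vec_eq_iff outer_def matrix_vector_mult_def inner_vec_def
      sum_distrib_left sum_distrib_right mult_ac)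

section \<open>Derivatives of Lipschitz maps on convex bodies\<close>

text \<open>
  At a boundary point the difference quotients of \<open>F\<close> at \<open>x\<close> control the derivative only on
  the cone of directions pointing into \<open>X\<close>. To reach an arbitrary \<open>h\<close>, write a multiple of it as
  the difference of two feasible directions, which is possible since \<open>X\<close> contains a ball,
  and compare \<open>F\<close> along the two rays: their points at time \<open>t\<close> have distance \<open>t \<parallel>v - w\<parallel>\<close>.
\<close>
lemma lipschitz_on_imp_derivative_bound:
  fixes F :: "'a::real_normed_vector \<Rightarrow> 'b::real_normed_vector"
  assumes der: "(F has_derivative F') (at x within X)" and lip: "L-lipschitz_on X F"
    and X: "convex X" "interior X \<noteq> {}" and x: "x \<in> X"
  shows "norm (F' h) \<le> L * norm h"
proof (cases "h = 0")
  case True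
  then show ?thesis
    using linear_0[OF has_derivative_linear[OF der]] by simp
next
  case False
  from X obtain c e where e: "e > 0" and ball: "ball c e \<subseteq> X"
    by (meson ex_in_conv mem_interior)
  define r where "r = e / (2 * norm h)"
  have r: "r > 0" using e False by (simp add: r_def)
  define v where "v = c + r *\<^sub>R h - x"
  define w where "w = c - x"
  have vw: "v - w = r *\<^sub>R h" by (simp add: v_def w_def)
  have "c + r *\<^sub>R h \<in> ball c e"
    using e False by (simp add: dist_norm r_def)
  then have "x + v \<in> X" "x + w \<in> X"
    using ball e by (auto simp: v_def w_def)
  then have ray: "x + t *\<^sub>R v \<in> X" "x + t *\<^sub>R w \<in> X" if "t \<in> {0..1}" for t
    using convexD_alt[OF X(1) x, of "x + v" t] convexD_alt[OF X(1) x, of "x + w" t] that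
    by (auto simp: algebra_simps)
  have along: "((\<lambda>t. F (x + t *\<^sub>R u)) has_vector_derivative F' u) (at 0 within {0..1})"
    if "\<And>t. t \<in> {0..1} \<Longrightarrow> x + t *\<^sub>R u \<in> X" for u
  proof -
    have "((\<lambda>t. x + t *\<^sub>R u) has_vector_derivative u) (at 0 within {0..1})"
      by (auto intro!: derivative_eq_intros)
    moreover have "(F has_derivative F') (at (x + 0 *\<^sub>R u) within (\<lambda>t. x + t *\<^sub>R u) ` {0..1})"
      using that by (auto intro!: has_derivative_subset[OF der])
    ultimately show ?thesis
      by (rule vector_derivative_diff_chain_within[unfolded o_def])
  qed
  let ?D = "\<lambda>t. F (x + t *\<^sub>R v) - F (x + t *\<^sub>R w)"
  have "(?D has_vector_derivative F' v - F' w) (at 0 within {0..1})"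
    by (intro has_vector_derivative_diff along ray)
  then have lim: "((\<lambda>t. norm (?D t - ?D 0 - (t - 0) *\<^sub>R (F' v - F' w)) / norm (t - 0))
      \<longlongrightarrow> 0) (at 0 within {0..1})"
    unfolding has_vector_derivative_def has_derivative_iff_norm by (rule conjunct2)
  have bound: "norm (F' v - F' w) - L * norm (v - w)
      \<le> norm (?D t - ?D 0 - (t - 0) *\<^sub>R (F' v - F' w)) / norm (t - 0)"
    if "t \<in> {0..1}" "t \<noteq> 0" for t
  proof -
    have t: "t > 0" using that by simp
    have "norm (?D t) \<le> L * norm ((x + t *\<^sub>R v) - (x + t *\<^sub>R w))"
      by (rule lipschitz_on_normD[OF lip ray[OF that(1)]])
    also have "(x + t *\<^sub>R v) - (x + t *\<^sub>R w) = t *\<^sub>R (v - w)"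
      by (simp add: algebra_simps)
    finally have "norm (?D t) \<le> t * (L * norm (v - w))"
      using t by (simp add: mult_ac)
    moreover have "t * norm (F' v - F' w) \<le> norm (?D t) + norm (?D t - t *\<^sub>R (F' v - F' w))"
      using norm_triangle_sub[of "t *\<^sub>R (F' v - F' w)" "?D t"] t
      by (simp only: norm_scaleR norm_minus_commute real_norm_def abs_of_pos)
    ultimately have "(norm (F' v - F' w) - L * norm (v - w)) * t
        \<le> norm (?D t - t *\<^sub>R (F' v - F' w))"
      by (simp add: left_diff_distrib right_diff_distrib mult.commute)
    then show ?thesis
      using t by (simp add: pos_le_divide_eq)
  qed
  have "norm (F' v - F' w) - L * norm (v - w) \<le> 0"
  proof (rule tendsto_lowerbound[OF lim])
    show "\<forall>\<^sub>F t in at 0 within {0..1}. norm (F' v - F' w) - L * norm (v - w)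
        \<le> norm (?D t - ?D 0 - (t - 0) *\<^sub>R (F' v - F' w)) / norm (t - 0)"
      using bound by (auto simp only: eventually_at_filter intro!: always_eventually)
    show "at 0 within {0..1::real} \<noteq> bot"
      by (simp add: at_within_Icc_at_right)
  qed
  then have "norm (F' v - F' w) \<le> L * norm (v - w)"
    by simp
  also have "F' v - F' w = r *\<^sub>R F' h"
    using has_derivative_linear[OF der] by (metis vw linear_diff linear_scale)
  finally show ?thesis
    using r by (simp add: vw)
qed

lemma matrix_opnorm_jacobian_le_lipschitz:
  fixes F :: "real^'n \<Rightarrow> real^'m"
  assumes "F differentiable (at x within X)" "L-lipschitz_on X F"
    and "convex X" "interior X \<noteq> {}" "x \<in> X"
  shows "matrix_opnorm (jacobian F (at x within X)) \<le> L"
proof (rule matrix_opnorm_le)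
  fix v
  have "(F has_derivative (\<lambda>h. jacobian F (at x within X) *v h)) (at x within X)"
    using assms(1) by (simp add: jacobian_works)
  then show "norm (jacobian F (at x within X) *v v) \<le> L * norm v"
    by (rule lipschitz_on_imp_derivative_bound[OF _ assms(2-5)])
qed

section \<open>Loewner bounds\<close>

text \<open>
  The polynomial \<open>t \<mapsto> (u + t v) \<bullet> A (u + t v)\<close> of degree at most two is nowhere negative, so
  its discriminant is at most zero.
\<close>
lemma psd_Cauchy_Schwarz:
  fixes A :: "real^'n^'n"
  assumes "0 \<preceq>\<^sub>L A"
  shows "(u \<bullet> (A *v v))\<^sup>2 \<le> (u \<bullet> (A *v u)) * (v \<bullet> (A *v v))"
proof -
  have psd: "0 \<le> w \<bullet> (A *v w)" for w
    using assms by (auto simp: loewner_le_def)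
  have sym: "v \<bullet> (A *v u) = u \<bullet> (A *v v)"
    using assms unfolding loewner_le_def
    by (metis dot_lmul_matrix inner_commute transpose_matrix_vector)
  define a b c where "a = u \<bullet> (A *v u)" and "b = u \<bullet> (A *v v)" and "c = v \<bullet> (A *v v)"
  have quad: "0 \<le> a + 2 * b * t + c * t\<^sup>2" for t
  proof -
    have "(u + t *\<^sub>R v) \<bullet> (A *v (u + t *\<^sub>R v)) = a + t * b + t * (b + t * c)"
      by (simp add: a_def b_def c_def sym matrix_vector_mult_scaleR
          matrix_vector_right_distrib inner_add_left inner_add_right algebra_simps)
    then show ?thesis
      using psd[of "u + t *\<^sub>R v"] by (simp add: algebra_simps power2_eq_square)
  qed
  have "b\<^sup>2 \<le> a * c"
  proof (cases "c = 0")
    case True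
    \<comment> \<open>The polynomial is then affine in \<open>t\<close>, so it can only stay nonnegative if \<open>b = 0\<close>.\<close>
    have "b = 0"
    proof (rule ccontr)
      assume "b \<noteq> 0"
      then show False
        using quad[of "- (a + 1) / (2 * b)"] True by simp
    qed
    then show ?thesis using True by simp
  next
    case False
    then have "c > 0" using psd[of v] by (simp add: c_def)
    \<comment> \<open>\<open>t = - b / c\<close> minimises the polynomial.\<close>
    then show ?thesis
      using quad[of "- b / c"] by (simp add: field_simps power2_eq_square)
  qed
  then show ?thesis
    by (simp add: a_def b_def c_def)
qed

text \<open>
  The order only bounds the quadratic form of \<open>A\<close>; Cauchy-Schwarz for that form,
  applied to \<open>A v\<close> and \<open>v\<close>, turns this into a bound on \<open>\<parallel>A v\<parallel>\<close>.
\<close>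
lemma matrix_opnorm_le_if_loewner_between:
  fixes A :: "real^'n^'n"
  assumes psd: "0 \<preceq>\<^sub>L A" and le: "A \<preceq>\<^sub>L C *\<^sub>R mat 1" and C: "0 \<le> C"
  shows "matrix_opnorm A \<le> C"
proof (rule matrix_opnorm_le)
  fix v
  have form: "0 \<le> u \<bullet> (A *v u)" "u \<bullet> (A *v u) \<le> C * (norm u)\<^sup>2" for u
    using psd le
    by (auto simp: loewner_le_def matrix_vector_mult_diff_rdistrib inner_diff_right
        scaleR_matrix_vector_assoc[symmetric] power2_norm_eq_inner)
  let ?u = "A *v v"
  have "((norm ?u)\<^sup>2)\<^sup>2 \<le> (?u \<bullet> (A *v ?u)) * (v \<bullet> (A *v v))"
    using psd_Cauchy_Schwarz[OF psd, of ?u v] by (simp add: power2_norm_eq_inner)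
  also have "\<dots> \<le> (C * (norm ?u)\<^sup>2) * (C * (norm v)\<^sup>2)"
    using form C by (intro mult_mono) auto
  also have "\<dots> = (norm ?u)\<^sup>2 * (C * norm v)\<^sup>2"
    by (simp add: power2_eq_square)
  finally have "(norm ?u)\<^sup>2 * (norm ?u)\<^sup>2 \<le> (norm ?u)\<^sup>2 * (C * norm v)\<^sup>2"
    by (simp add: power2_eq_square)
  then have "(norm ?u)\<^sup>2 \<le> (C * norm v)\<^sup>2" if "?u \<noteq> 0"
    by (rule mult_left_le_imp_le) (simp add: that)
  then show "norm ?u \<le> C * norm v"
    using C by (cases "?u = 0") (auto intro: power2_le_imp_le)
qed

section \<open>Growth of Broyden iterates\<close>

text \<open>
  Shortening the component along \<open>s\<close> by the factor \<open>1 - a\<close> changes the squared norm by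
  \<open>- a (2 - a) (s \<bullet> v)\<^sup>2 / (s \<bullet> s)\<close>.
\<close>
lemma norm_damped_projection_le:
  fixes s v :: "'a::real_inner"
  assumes "0 \<le> a" "a \<le> 1"
  shows "norm (v - (a * ((s \<bullet> v) / (s \<bullet> s))) *\<^sub>R s) \<le> norm v"
proof (cases "s = 0")
  case False
  define k where "k = (s \<bullet> v) / (s \<bullet> s)"
  have k: "s \<bullet> v = k * (s \<bullet> s)" using False by (simp add: k_def)
  have "(norm (v - (a * k) *\<^sub>R s))\<^sup>2
      = v \<bullet> v - 2 * (a * k) * (s \<bullet> v) + (a * k)\<^sup>2 * (s \<bullet> s)"
    unfolding power2_norm_eq_inner
    by (simp add: inner_diff_left inner_diff_right inner_commute power2_eq_square)
  also have "\<dots> = (norm v)\<^sup>2 - a * (2 - a) * (k\<^sup>2 * (s \<bullet> s))"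
    unfolding k power2_norm_eq_inner by (simp add: algebra_simps power2_eq_square)
  also have "\<dots> \<le> (norm v)\<^sup>2"
    using assms by simp
  finally have "norm (v - (a * k) *\<^sub>R s) \<le> norm v"
    by (rule power2_le_imp_le) simp
  then show ?thesis
    by (simp only: k_def)
qed simp

text \<open>
  Grouped by \<open>B\<close> and \<open>y\<close>, the step applies \<open>B\<close> after a contraction and adds \<open>a k y\<close> with
  \<open>k = (s \<bullet> v) / (s \<bullet> s)\<close>, where \<open>\<bar>k\<bar> \<parallel>s\<parallel> \<le> \<parallel>v\<parallel>\<close> by Cauchy-Schwarz. The case \<open>s = 0\<close> is
  covered because then \<open>k = 0\<close>.
\<close>
lemma matrix_opnorm_broyden_step_le:
  fixes B :: "real^'n^'n"
  assumes a: "0 \<le> a" "a \<le> 1" and y: "norm y \<le> L * norm s" and L: "0 \<le> L"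
  shows "matrix_opnorm (B + a *\<^sub>R ((1 / (s \<bullet> s)) *\<^sub>R outer (y - B *v s) s))
    \<le> matrix_opnorm B + a * L"
proof (rule matrix_opnorm_le)
  fix v
  define k where "k = (s \<bullet> v) / (s \<bullet> s)"
  have "(B + a *\<^sub>R ((1 / (s \<bullet> s)) *\<^sub>R outer (y - B *v s) s)) *v v
      = B *v v + (a * k) *\<^sub>R (y - B *v s)"
    by (simp add: k_def matrix_vector_mult_add_rdistrib outer_mult_vector
        scaleR_matrix_vector_assoc[symmetric])
  also have "\<dots> = B *v (v - (a * k) *\<^sub>R s) + (a * k) *\<^sub>R y"
    by (simp add: matrix_vector_mult_diff_distrib matrix_vector_mult_scaleR algebra_simps)
  finally have step: "(B + a *\<^sub>R ((1 / (s \<bullet> s)) *\<^sub>R outer (y - B *v s) s)) *v v = \<dots>" .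
  have "norm (B *v (v - (a * k) *\<^sub>R s)) \<le> matrix_opnorm B * norm (v - (a * k) *\<^sub>R s)"
    by (rule norm_matrix_vector_mult_le)
  also have "\<dots> \<le> matrix_opnorm B * norm v"
    unfolding k_def matrix_opnorm_def
    by (intro mult_left_mono norm_damped_projection_le a onorm_pos_le
        matrix_vector_mul_bounded_linear)
  finally have 1: "norm (B *v (v - (a * k) *\<^sub>R s)) \<le> matrix_opnorm B * norm v" .
  have "\<bar>k\<bar> * norm s \<le> norm v"
  proof (cases "s = 0")
    case False
    have "\<bar>k\<bar> * norm s = \<bar>s \<bullet> v\<bar> / norm s"
      using False by (simp add: k_def abs_divide power2_norm_eq_inner[symmetric] power2_eq_square)
    also have "\<dots> \<le> norm v"
      using False Cauchy_Schwarz_ineq2[of s v] by (simp add: field_simps)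
    finally show ?thesis .
  qed simp
  then have "L * (\<bar>k\<bar> * norm s) \<le> L * norm v"
    using L by (rule mult_left_mono)
  moreover have "\<bar>k\<bar> * norm y \<le> \<bar>k\<bar> * (L * norm s)"
    using y by (simp add: mult_left_mono)
  ultimately have "\<bar>k\<bar> * norm y \<le> L * norm v"
    by (simp add: mult_ac)
  then have 2: "norm ((a * k) *\<^sub>R y) \<le> a * L * norm v"
    using a mult_left_mono[of _ _ a] by (simp add: abs_mult mult.assoc)
  show "norm ((B + a *\<^sub>R ((1 / (s \<bullet> s)) *\<^sub>R outer (y - B *v s) s)) *v v)
      \<le> (matrix_opnorm B + a * L) * norm v"
    unfolding step using norm_triangle_mono[OF 1 2] by (simp add: algebra_simps)
qed

lemma matrix_opnorm_broyden_iter_le: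
  assumes "0 \<le> a" "a \<le> 1" "0 \<le> L" and "\<And>i. i < m \<Longrightarrow> norm (y i) \<le> L * norm (s i)"
  shows "matrix_opnorm (broyden_iter a s y J0 m) \<le> matrix_opnorm J0 + real m * (a * L)"
  using assms(4)
proof (induction m)
  case (Suc m)
  have "matrix_opnorm (broyden_iter a s y J0 (Suc m))
      \<le> matrix_opnorm (broyden_iter a s y J0 m) + a * L"
    using matrix_opnorm_broyden_step_le[OF assms(1,2) Suc.prems assms(3)] by simp
  with Suc show ?case by (simp add: algebra_simps)
qed simp

section \<open>The inexactness bounds\<close>

text \<open>
  Both sampling rules enter only through this growth bound: secant pairs inherit it from the
  Lipschitz condition, Jacobian-vector products from the norm of the Jacobian.
\<close>
lemma broyden_pairs_norm_le:
  assumes "broyden_pairs M X F x m s y" "L-lipschitz_on X F"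
    and "matrix_opnorm (jacobian F (at x within X)) \<le> L"
    and "w \<in> space M" "i < m"
  shows "norm (y i w) \<le> L * norm (s i w)"
  using assms(1) unfolding broyden_pairs_def
proof
  assume "\<forall>w\<in>space M. operator_history X F m (\<lambda>i. s i w) (\<lambda>i. y i w)"
  then obtain z where "z i \<in> X" "z (Suc i) \<in> X"
    "s i w = z (Suc i) - z i" "y i w = F (z (Suc i)) - F (z i)"
    using assms(4,5) unfolding operator_history_def by (meson Suc_leI less_imp_le)
  then show ?thesis
    using lipschitz_on_normD[OF assms(2)] by simp
next
  assume "jvp_sampling M (jacobian F (at x within X)) m s y"
  then have "y i w = jacobian F (at x within X) *v s i w"
    using assms(4,5) by (auto simp: jvp_sampling_def)
  then show ?thesis
    using norm_matrix_vector_mult_le order_trans mult_right_mono[OF assms(3) norm_ge_zero]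
    by metis
qed

theorem theorem5p1:
  fixes X :: "(real^'n) set" and F :: "real^'n \<Rightarrow> real^'n" and x :: "real^'n"
    and L0 :: real and m :: nat
    and M :: "'w measure" and s y :: "nat \<Rightarrow> 'w \<Rightarrow> real^'n"
  assumes "closed X" "bounded X" "convex X" "interior X \<noteq> {}"
    and "continuous_on X F" "F differentiable_on X"
    and "x \<in> X"
    and "L0-lipschitz_on X F"
    and "prob_space M"
    and "broyden_pairs M X F x m s y"
  shows "\<forall>w\<in>space M.
      (\<forall>J0. 0 \<preceq>\<^sub>L J0 \<and> J0 \<preceq>\<^sub>L L0 *\<^sub>R mat 1 \<longrightarrow>
        (\<exists>\<delta>\<le>(real m + 2) * L0.
           matrix_opnorm (jacobian F (at x within X) - l_broyden m (\<lambda>i. s i w) (\<lambda>i. y i w) J0) \<le> \<delta>))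
    \<and> (\<forall>J0. 0 \<preceq>\<^sub>L J0 \<and> J0 \<preceq>\<^sub>L (L0 / (real m + 1)) *\<^sub>R mat 1 \<longrightarrow>
        (\<exists>\<delta>\<le>2 * L0.
           matrix_opnorm (jacobian F (at x within X) - damped_l_broyden m (\<lambda>i. s i w) (\<lambda>i. y i w) J0) \<le> \<delta>))"
proof -
  let ?J = "jacobian F (at x within X)"
  have L0: "0 \<le> L0"
    using assms(8) by (rule lipschitz_on_nonneg)
  have J: "matrix_opnorm ?J \<le> L0"
    using assms(3,4,6-8) by (intro matrix_opnorm_jacobian_le_lipschitz) (auto simp: differentiable_on_def)
  have error: "matrix_opnorm (?J - broyden_iter a (\<lambda>i. s i w) (\<lambda>i. y i w) J0 m)
      \<le> L0 + (C + real m * (a * L0))"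
    if "w \<in> space M" "0 \<le> a" "a \<le> 1" "0 \<preceq>\<^sub>L J0" "J0 \<preceq>\<^sub>L C *\<^sub>R mat 1" "0 \<le> C" for w a C J0
  proof -
    have "matrix_opnorm (broyden_iter a (\<lambda>i. s i w) (\<lambda>i. y i w) J0 m)
        \<le> matrix_opnorm J0 + real m * (a * L0)"
      using broyden_pairs_norm_le[OF assms(10,8) J that(1)] that(2,3) L0
      by (intro matrix_opnorm_broyden_iter_le)
    moreover have "matrix_opnorm J0 \<le> C"
      using that(4-6) by (rule matrix_opnorm_le_if_loewner_between)
    ultimately show ?thesis
      using J matrix_opnorm_diff_le[of ?J "broyden_iter a (\<lambda>i. s i w) (\<lambda>i. y i w) J0 m"]
      by linarith
  qed
  show ?thesis
  proof (intro ballI conjI allI impI; elim conjE)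
    fix w and J0 :: "real^'n^'n"
    assume w: "w \<in> space M" "0 \<preceq>\<^sub>L J0" "J0 \<preceq>\<^sub>L L0 *\<^sub>R mat 1"
    have "matrix_opnorm (?J - l_broyden m (\<lambda>i. s i w) (\<lambda>i. y i w) J0) \<le> (real m + 2) * L0"
      using error[OF w(1) _ _ w(2,3) L0, of 1] by (simp add: l_broyden_def algebra_simps)
    then show "\<exists>\<delta>\<le>(real m + 2) * L0.
        matrix_opnorm (?J - l_broyden m (\<lambda>i. s i w) (\<lambda>i. y i w) J0) \<le> \<delta>"
      by blast
  next
    fix w and J0 :: "real^'n^'n"
    assume w: "w \<in> space M" "0 \<preceq>\<^sub>L J0" "J0 \<preceq>\<^sub>L (L0 / (real m + 1)) *\<^sub>R mat 1"
    have "L0 / (real m + 1) + real m * (1 / (real m + 1) * L0)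
        = (real m + 1) * (L0 / (real m + 1))"
      unfolding distrib_right by simp
    then have "L0 + (L0 / (real m + 1) + real m * (1 / (real m + 1) * L0)) = 2 * L0"
      by simp
    moreover have "matrix_opnorm (?J - damped_l_broyden m (\<lambda>i. s i w) (\<lambda>i. y i w) J0)
        \<le> L0 + (L0 / (real m + 1) + real m * (1 / (real m + 1) * L0))"
      unfolding damped_l_broyden_def using L0 by (intro error w) auto
    ultimately show "\<exists>\<delta>\<le>2 * L0.
        matrix_opnorm (?J - damped_l_broyden m (\<lambda>i. s i w) (\<lambda>i. y i w) J0) \<le> \<delta>"
      by auto
  qed
qed

end
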